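(* Every class of graphs with bounded crossing number is included in a proper minor-closed class: for every constant $c$, there is a proper minor-closed class of graphs containing every graph $G$ whose crossing number is at most $c$.
   Context: All graphs are finite and simple. The crossing number of a graph $G$ is the minimum number of crossings in a drawing of $G$ in the plane. A class of graphs is minor-closed if it is closed under vertex deletions, edge deletions and edge contractions (with resulting graphs simple); it is proper if some finite simple graph is not in the class. *)

theory Defs
  imports
    "HOL-Analysis.Analysis"
    "HOL-Library.Extended_Nat"
    "HOL-Library.Infinite_Typeclass"
begin

section \<open>Finite simple graphs and minor operations\<close>

text \<open>A graph is a pair of a vertex set and a set of edges; an edge is a two-element set of
  vertices.\<close>

type_synonym 'a graph = "'a set \<times> 'a set set"

abbreviation verts :: "'a graph \<Rightarrow> 'a set" where "verts G \<equiv> fst G"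

abbreviation edges :: "'a graph \<Rightarrow> 'a set set" where "edges G \<equiv> snd G"

definition simple_graph :: "'a graph \<Rightarrow> bool" where
  "simple_graph G \<longleftrightarrow>
     finite (verts G) \<and> (\<forall>e\<in>edges G. e \<subseteq> verts G \<and> card e = 2)"

definition isomorphic :: "'a graph \<Rightarrow> 'b graph \<Rightarrow> bool" where
  "isomorphic G H \<longleftrightarrow>
     (\<exists>f. bij_betw f (verts G) (verts H) \<and> (\<lambda>e. f ` e) ` edges G = edges H)"

definition delete_vertex :: "'a graph \<Rightarrow> 'a \<Rightarrow> 'a graph" where
  "delete_vertex G v = (verts G - {v}, {e \<in> edges G. v \<notin> e})"

definition delete_edge :: "'a graph \<Rightarrow> 'a set \<Rightarrow> 'a graph" where
  "delete_edge G e = (verts G, edges G - {e})"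

text \<open>Contraction of the edge \<open>{u, v}\<close>: the merged vertex keeps the name \<open>u\<close>. The condition
  on the cardinality discards the loop arising from \<open>{u, v}\<close>, and parallel edges are identified
  because edges form a set.\<close>

definition contract_edge :: "'a graph \<Rightarrow> 'a \<Rightarrow> 'a \<Rightarrow> 'a graph" where
  "contract_edge G u v =
     (verts G - {v},
      {e \<in> (\<lambda>f. (\<lambda>x. if x = v then u else x) ` f) ` edges G. card e = 2})"

text \<open>As usual, a class of graphs is closed under isomorphism. Over an infinite vertex type every
  finite graph has an isomorphic copy, so such a set stands for a class of finite graphs; over a
  finite type there would be too few graphs for properness to be meaningful.\<close>

definition graph_class :: "'a graph set \<Rightarrow> bool" where
  "graph_class \<C> \<longleftrightarrow>
     (\<forall>G\<in>\<C>. simple_graph G) \<and>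
     (\<forall>G\<in>\<C>. \<forall>H. simple_graph H \<and> isomorphic G H \<longrightarrow> H \<in> \<C>)"

definition minor_closed :: "'a graph set \<Rightarrow> bool" where
  "minor_closed \<C> \<longleftrightarrow>
     (\<forall>G\<in>\<C>.
        (\<forall>v\<in>verts G. delete_vertex G v \<in> \<C>) \<and>
        (\<forall>e\<in>edges G. delete_edge G e \<in> \<C>) \<and>
        (\<forall>u v. {u, v} \<in> edges G \<longrightarrow> contract_edge G u v \<in> \<C>))"

definition proper_class :: "'a graph set \<Rightarrow> bool" where
  "proper_class \<C> \<longleftrightarrow> (\<exists>G. simple_graph G \<and> G \<notin> \<C>)"


section \<open>Drawings and the crossing number\<close>

text \<open>A drawing represents vertices by distinct points of the plane (\<open>complex\<close>, as in the
  Jordan curve theorem of the library) and each edge by a simple arc between its endpoints.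
  No edge passes through a vertex other than its endpoints, and no three edges
  meet in a point other than a common endpoint.\<close>

definition is_drawing ::
    "'a graph \<Rightarrow> ('a \<Rightarrow> complex) \<Rightarrow> ('a set \<Rightarrow> real \<Rightarrow> complex) \<Rightarrow> bool" where
  "is_drawing G pos \<gamma> \<longleftrightarrow>
     inj_on pos (verts G) \<and>
     (\<forall>e\<in>edges G. arc (\<gamma> e) \<and> {pathstart (\<gamma> e), pathfinish (\<gamma> e)} = pos ` e) \<and>
     (\<forall>e\<in>edges G. \<forall>v\<in>verts G. pos v \<in> path_image (\<gamma> e) \<longrightarrow> v \<in> e) \<and>
     (\<forall>e\<in>edges G. \<forall>f\<in>edges G. \<forall>g\<in>edges G. e \<noteq> f \<and> f \<noteq> g \<and> e \<noteq> g \<longrightarrow>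
        path_image (\<gamma> e) \<inter> path_image (\<gamma> f) \<inter> path_image (\<gamma> g) \<subseteq> pos ` (e \<inter> f \<inter> g))"

text \<open>A crossing is a common point of two edges other than a common endpoint. Since no three
  edges cross in one point, a crossing point determines the two edges that cross there, so
  counting points is counting crossings. Points where two edges merely touch are counted as well.\<close>

definition crossings ::
    "'a graph \<Rightarrow> ('a \<Rightarrow> complex) \<Rightarrow> ('a set \<Rightarrow> real \<Rightarrow> complex) \<Rightarrow> complex set" where
  "crossings G pos \<gamma> =
     (\<Union>e\<in>edges G. \<Union>f\<in>edges G - {e}.
        path_image (\<gamma> e) \<inter> path_image (\<gamma> f) - pos ` (e \<inter> f))"

definition num_crossings ::
    "'a graph \<Rightarrow> ('a \<Rightarrow> complex) \<Rightarrow> ('a set \<Rightarrow> real \<Rightarrow> complex) \<Rightarrow> enat" where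
  "num_crossings G pos \<gamma> =
     (if finite (crossings G pos \<gamma>) then enat (card (crossings G pos \<gamma>)) else \<infinity>)"

text \<open>The infimum of a nonempty set of extended naturals is attained, so this is a minimum.\<close>

definition crossing_number :: "'a graph \<Rightarrow> enat" where
  "crossing_number G = Inf {num_crossings G pos \<gamma> |pos \<gamma>. is_drawing G pos \<gamma>}"

end

theory Submission
  imports Defs
begin

text \<open>The class is that of the graphs without a minor isomorphic to \<open>c + 1\<close> disjoint copies of
  \<open>K\<^sub>3\<^sub>,\<^sub>3\<close>. Excluding a fixed minor gives a minor-closed class because minor models compose
  (\<open>minor_model_trans\<close>) and each of the three minor operations, as well as each isomorphism,
  produces a minor model; the class is proper because it misses a copy of the excluded graph.

  Suppose a drawn graph contains the excluded minor. The branch sets of one copy of \<open>K\<^sub>3\<^sub>,\<^sub>3\<close>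
  span a subgraph, and the edges of this subgraph must cross somewhere, since \<open>K\<^sub>3\<^sub>,\<^sub>3\<close> is not planar
  (\<open>crossing_in_K33_model\<close>). Subgraphs of different copies are vertex-disjoint. A point in which
  a pair of edges of one copy crosses therefore lies on no edge of another copy, because three edges
  never meet outside a common endpoint. So the \<open>c + 1\<close> copies yield \<open>c + 1\<close> different crossings.

  Nonplanarity is proved directly for minor models, with branch sets replaced by path-connected
  subsets of the plane (\<open>no_planar_K33_of_connected_sets\<close>). Two of the branch sets on one side
  are thinned to tripods (\<open>tripod\<close>). The tripods and the three branch sets of the other side
  contain three arcs with common ends, a theta curve. The sixth branch set lies in a
  face of the theta curve and is connected to all three arcs, but a face of a theta curve has only two of
  the arcs on its boundary (\<open>theta_curve_hub\<close>).\<close>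

section \<open>Theta curves\<close>


lemma arc_interior_point:
  assumes "arc g"
  obtains q where "q \<in> path_image g" "q \<noteq> pathstart g" "q \<noteq> pathfinish g"
proof -
  have "inj_on g {0..1}" using assms by (simp add: arc_def)
  then have "g (1/2) \<noteq> g 0" "g (1/2) \<noteq> g 1" by (simp_all add: inj_on_eq_iff)
  then show thesis
    using that[of "g (1/2)"] by (auto simp: path_image_def pathstart_def pathfinish_def)
qed

text \<open>On the sphere all three cycles of a theta curve look alike, but exactly one of them is the
  boundary of the face containing infinity, and the third arc is inside that one. If no arc were
  inside the cycle of the other two, a point inside one cycle would be outside
  the other two. Two cycles meet in a connected set, namely one arc, so by Janiszewski's theorem
  their union would not separate the point from infinity. That union is the whole theta
  curve, which does.\<close>

lemma arc_inside_of_theta_curve: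
  fixes P :: "nat \<Rightarrow> real \<Rightarrow> complex"
  assumes arc: "\<And>i. i < 3 \<Longrightarrow> arc (P i)"
    and start: "\<And>i. i < 3 \<Longrightarrow> pathstart (P i) = a"
    and finish: "\<And>i. i < 3 \<Longrightarrow> pathfinish (P i) = b"
    and disj: "\<And>i j. i < 3 \<Longrightarrow> j < 3 \<Longrightarrow> i \<noteq> j \<Longrightarrow>
                 path_image (P i) \<inter> path_image (P j) = {a, b}"
  shows "\<exists>i j k. i < 3 \<and> j < 3 \<and> k < 3 \<and> distinct [i, j, k] \<and>
           path_image (P k) \<inter> inside (path_image (P i) \<union> path_image (P j)) \<noteq> {}"
proof (rule ccontr)
  assume neg: "\<not> ?thesis"
  have jordan: "simple_path (P i +++ reversepath (P j)) \<and>
      pathfinish (P i +++ reversepath (P j)) = pathstart (P i +++ reversepath (P j)) \<and>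
      path_image (P i +++ reversepath (P j)) = path_image (P i) \<union> path_image (P j)"
    if "i < 3" "j < 3" "i \<noteq> j" for i j
    using that arc start finish disj[of i j]
    by (simp add: simple_path_join_loop_eq path_image_join arc_reversepath)
  define J where "J i j = path_image (P i) \<union> path_image (P j)" for i j
  have J: "inside (J i j) \<noteq> {} \<and> open (inside (J i j)) \<and> connected (inside (J i j)) \<and>
      connected (outside (J i j)) \<and> inside (J i j) \<union> outside (J i j) = - J i j \<and>
      frontier (inside (J i j)) = J i j" if "i < 3" "j < 3" "i \<noteq> j" for i j
    using Jordan_inside_outside[of "P i +++ reversepath (P j)"] jordan[OF that]
    unfolding J_def by simp
  have compact: "compact (J i j)" if "i < 3" "j < 3" for i j
    using that arc by (simp add: J_def compact_arc_image compact_Un)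
  have avoid: "path_image (P k) \<inter> inside (J i j) = {}" 
    if "i < 3" "j < 3" "k < 3" "i \<noteq> j" for i j k
  proof (cases "k = i \<or> k = j")
    case True
    then show ?thesis using inside_no_overlap[of "J i j"] unfolding J_def by blast
  next
    case False
    then show ?thesis using neg that unfolding J_def by auto
  qed
  \<comment> \<open>If the inside of the curve through \<open>j\<close> lay inside the other curve, so would the points of arc
    \<open>j\<close>, which are on its frontier.\<close>
  have not_nested: "\<not> inside (J i j) \<subseteq> inside (J i k)"
    if ijk: "i < 3" "j < 3" "k < 3" "distinct [i, j, k]" for i j k
  proof
    assume sub: "inside (J i j) \<subseteq> inside (J i k)"
    obtain q where q: "q \<in> path_image (P j)" "q \<noteq> a" "q \<noteq> b"
      using arc_interior_point[OF arc[of j]] start[of j] finish[of j] ijk by auto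
    have "q \<in> closure (inside (J i j))"
      using J[of i j] ijk q(1) frontier_def[of "inside (J i j)"] by (auto simp: J_def)
    then have "q \<in> closure (inside (J i k))"
      using closure_mono[OF sub] by blast
    then have "q \<in> inside (J i k) \<or> q \<in> J i k"
      using J[of i k] ijk frontier_def[of "inside (J i k)"] interior_open by auto
    moreover have "q \<notin> J i k"
      using disj[of j i] disj[of j k] ijk q by (auto simp: J_def)
    moreover have "q \<notin> inside (J i k)"
      using avoid[of i k j] ijk q by auto
    ultimately show False by blast
  qed
  have in_outside: "r \<in> outside (J i k)"
    if r: "r \<in> inside (J i j)" and ijk: "i < 3" "j < 3" "k < 3" "distinct [i, j, k]" for r i j k
  proof (rule ccontr)
    assume "r \<notin> outside (J i k)"
    moreover have free: "inside (J i j) \<inter> J i k = {}"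
      using avoid[of i j i] avoid[of i j k] ijk by (auto simp: J_def)
    moreover have "inside (J i k) \<union> outside (J i k) = - J i k" using J[of i k] ijk by simp
    ultimately have "r \<in> inside (J i k)"
      using r by blast
    moreover have "connected (inside (J i j))" using J[of i j] ijk by simp
    ultimately have "inside (J i j) \<subseteq> inside (J i k)"
      using r free inside_same_component[of "J i k" r] unfolding connected_component_def by blast
    then show False using not_nested ijk by blast
  qed
  obtain r where r: "r \<in> inside (J 0 1)" using J[of 0 1] by auto
  have r1: "r \<in> outside (J 0 2)" using in_outside[OF r, of 2] by simp
  have r2: "r \<in> outside (J 1 2)"
    using in_outside[of r 1 0 2] r by (simp add: J_def Un_commute)
  \<comment> \<open>The point \<open>z\<close> plays the role of infinity.\<close>
  obtain z where z: "z \<in> outside (J 0 1 \<union> J 0 2 \<union> J 1 2)"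
  proof -
    have "bounded (J 0 1 \<union> J 0 2 \<union> J 1 2)"
      using compact by (simp add: compact_imp_bounded)
    then have "\<not> bounded (outside (J 0 1 \<union> J 0 2 \<union> J 1 2))"
      by (simp add: unbounded_outside)
    then show ?thesis using that by (metis bounded_empty ex_in_conv)
  qed
  have z': "z \<in> outside (J 0 1)" "z \<in> outside (J 0 2)" "z \<in> outside (J 1 2)"
    using z outside_mono[of _ "J 0 1 \<union> J 0 2 \<union> J 1 2"] by blast+
  have cc: "connected_component (- J i k) r z"
    if "r \<in> outside (J i k)" "z \<in> outside (J i k)" "i < 3" "k < 3" "i \<noteq> k" for i k
  proof -
    have "connected (outside (J i k))" "outside (J i k) \<subseteq> - J i k"
      using J[of i k] that outside_no_overlap[of "J i k"] by blast+
    then show ?thesis using that unfolding connected_component_def by blast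
  qed
  have "connected (J 0 2 \<inter> J 1 2)"
  proof -
    have "J 0 2 \<inter> J 1 2 = path_image (P 2)"
      using disj[of 0 1] disj[of 0 2] by (auto simp: J_def)
    then show ?thesis using arc[of 2] by (simp add: connected_arc_image)
  qed
  then have "connected_component (- (J 0 2 \<union> J 1 2)) r z"
    using Janiszewski[of "J 0 2" "J 1 2" r z] compact cc r1 r2 z'
    by (simp add: compact_imp_closed)
  then have "connected_component (- J 0 1) r z"
    by (rule connected_component_of_subset) (auto simp: J_def)
  then show False
    using r z'(1) inside_same_component[of "J 0 1" r z] inside_Int_outside[of "J 0 1"] by blast
qed

text \<open>The set \<open>C k\<close> joins the hub \<open>p\<close> to arc \<open>k\<close> without touching the other two arcs, so with respect
  to the closed curve formed by these two arcs \<open>p\<close> lies on the same side as arc \<open>k\<close>. Let arc \<open>k\<close> be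
  inside the curve of \<open>i\<close> and \<open>j\<close>. It cuts this inside into two pieces, and \<open>p\<close> lies in one of them,
  say that of \<open>i\<close> and \<open>k\<close>. Then arc \<open>j\<close> would be inside the curve of \<open>i\<close> and \<open>k\<close>, hence inside the
  curve of \<open>i\<close> and \<open>j\<close>, of which it is a part.\<close>

lemma theta_curve_hub:
  fixes P :: "nat \<Rightarrow> real \<Rightarrow> complex" and C :: "nat \<Rightarrow> complex set"
  assumes arc: "\<And>i. i < 3 \<Longrightarrow> arc (P i)"
    and start: "\<And>i. i < 3 \<Longrightarrow> pathstart (P i) = a"
    and finish: "\<And>i. i < 3 \<Longrightarrow> pathfinish (P i) = b"
    and disj: "\<And>i j. i < 3 \<Longrightarrow> j < 3 \<Longrightarrow> i \<noteq> j \<Longrightarrow>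
                 path_image (P i) \<inter> path_image (P j) = {a, b}"
    and con: "\<And>k. k < 3 \<Longrightarrow> connected (C k)"
    and hub: "\<And>k. k < 3 \<Longrightarrow> p \<in> C k"
    and meets: "\<And>k. k < 3 \<Longrightarrow> C k \<inter> path_image (P k) \<noteq> {}"
    and avoids: "\<And>i k. i < 3 \<Longrightarrow> k < 3 \<Longrightarrow> i \<noteq> k \<Longrightarrow> C k \<inter> path_image (P i) = {}"
  shows False
proof -
  define J where "J i j = path_image (P i) \<union> path_image (P j)" for i j
  have ends: "a \<in> path_image (P i)" "b \<in> path_image (P i)" if "i < 3" for i
    using start[OF that] finish[OF that] by (auto simp: pathstart_in_path_image pathfinish_in_path_image)
  have same_side: "p \<in> inside (J i j) \<longleftrightarrow> q \<in> inside (J i j)"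
    if ijk: "i < 3" "j < 3" "k < 3" "distinct [i, j, k]"
      and q: "q \<in> path_image (P k)" "q \<noteq> a" "q \<noteq> b" for i j k q
  proof -
    let ?R = "path_image (P k) - {a, b}"
    have R: "connected ?R"
      using connected_simple_path_endless[of "P k"] arc[of k] start[of k] finish[of k] ijk
      by (simp add: arc_imp_simple_path)
    have "C k \<inter> {a, b} = {}" using avoids[of i k] ends[of i] ijk by auto
    then have "C k \<inter> ?R \<noteq> {}" using meets[of k] ijk by auto
    then have "connected (C k \<union> ?R)" using connected_Un con R ijk by blast
    moreover have "C k \<union> ?R \<subseteq> - J i j"
      using avoids[of i k] avoids[of j k] disj[of i k] disj[of j k] ijk by (auto simp: J_def)
    ultimately have "connected_component (- J i j) p q"
      using hub[of k] ijk q by (auto simp: connected_component_def intro!: exI[of _ "C k \<union> ?R"])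
    then show ?thesis by (meson connected_component_sym inside_same_component)
  qed
  obtain i j k where ijk: "i < 3" "j < 3" "k < 3" "distinct [i, j, k]"
    and "path_image (P k) \<inter> inside (J i j) \<noteq> {}"
    using arc_inside_of_theta_curve[of P a b, OF arc start finish disj] unfolding J_def by blast
  then obtain q where q: "q \<in> path_image (P k)" "q \<in> inside (J i j)" by blast
  have "a \<noteq> b" using arc_distinct_ends[OF arc[of 0]] start[of 0] finish[of 0] by simp
  have "simple_path (P l)" if "l < 3" for l using arc[OF that] by (rule arc_imp_simple_path)
  then have split: "inside (J i k) \<union> inside (J j k) \<union> (path_image (P k) - {a, b}) = inside (J i j)"
    using split_inside_simple_closed_curve[of "P i" a b "P j" "P k"] start finish disj ijk
      \<open>a \<noteq> b\<close> q unfolding J_def by (smt (verit) disjoint_iff distinct_length_2_or_more)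
  have no_ends: "{a, b} \<inter> inside (J i j) = {}"
    using ends[of i] ijk inside_no_overlap[of "J i j"] J_def[of i j] by blast
  have "p \<in> inside (J i j)" using same_side[of i j k q] ijk q no_ends by auto
  moreover have "p \<notin> path_image (P k)" using hub[of i] avoids[of k i] ijk by auto
  ultimately have "p \<in> inside (J i k) \<or> p \<in> inside (J j k)" using split by blast
  moreover have False
    if p: "p \<in> inside (J l k)" and l: "l = i \<and> m = j \<or> l = j \<and> m = i" for l m
  proof -
    obtain s where s: "s \<in> path_image (P m)" "s \<noteq> a" "s \<noteq> b"
      using arc_interior_point[OF arc[of m]] start[of m] finish[of m] ijk l by auto
    have "s \<in> inside (J l k)" using same_side[of l k m s] p s ijk l by auto
    then have "s \<in> inside (J i j)" using split l by blast
    then show False using s l inside_no_overlap[of "J i j"] unfolding J_def by blast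
  qed
  ultimately show False by blast
qed

section \<open>The complete bipartite graph on three and three connected sets\<close>

text \<open>An arc from \<open>x 0\<close> to \<open>x 1\<close> is cut at the first point \<open>y\<close> in which a path from \<open>x 2\<close> meets it.
  The legs may degenerate to a single point.\<close>

lemma tripod:
  fixes B :: "complex set" and x :: "nat \<Rightarrow> complex"
  assumes B: "path_connected B" and x: "\<And>i. i < 3 \<Longrightarrow> x i \<in> B"
  shows "\<exists>y U. (\<forall>i<3. compact (U i) \<and> path_connected (U i) \<and> U i \<subseteq> B \<and> x i \<in> U i \<and> y \<in> U i) \<and>
           (\<forall>i<3. \<forall>j<3. i \<noteq> j \<longrightarrow> U i \<inter> U j \<subseteq> {y})"
proof -
  define legs where "legs y U0 U1 U2 \<longleftrightarrow>
      (\<forall>U\<in>{U0, U1, U2}. compact U \<and> path_connected U \<and> U \<subseteq> B \<and> y \<in> U) \<and>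
      x 0 \<in> U0 \<and> x 1 \<in> U1 \<and> x 2 \<in> U2 \<and>
      U0 \<inter> U1 \<subseteq> {y} \<and> U0 \<inter> U2 \<subseteq> {y} \<and> U1 \<inter> U2 \<subseteq> {y}" for y U0 U1 U2
  have "\<exists>y U0 U1 U2. legs y U0 U1 U2"
  proof (cases "x 0 = x 1")
    case True
    obtain h where h: "path h" "path_image h \<subseteq> B" "pathstart h = x 0" "pathfinish h = x 2"
      using B x[of 0] x[of 2] unfolding path_connected_def by force
    have "x 0 \<in> path_image h" "x 2 \<in> path_image h"
      using h by (metis pathstart_in_path_image, metis pathfinish_in_path_image)
    moreover have "compact (path_image h)" "path_connected (path_image h)"
      using h(1) by (simp_all add: compact_path_image path_connected_path_image)
    moreover have "x 0 \<in> B" using x[of 0] by simp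
    ultimately have "legs (x 0) {x 0} {x 0} (path_image h)"
      unfolding legs_def using h(2) True by simp
    then show ?thesis by blast
  next
    case False
    then obtain g where g: "arc g" "path_image g \<subseteq> B" "pathstart g = x 0" "pathfinish g = x 1"
      using B x[of 0] x[of 1] unfolding path_connected_arcwise by force
    obtain h where h: "path h" "path_image h \<subseteq> B" "pathstart h = x 2" "pathfinish h = x 0"
      using B x[of 0] x[of 2] unfolding path_connected_def by force
    have cg: "continuous_on {0..1} g" and ch: "continuous_on {0..1} h"
      using g(1) h(1) by (auto simp: arc_def path_def)
    have inj: "inj_on g {0..1}" using g(1) by (simp add: arc_def)
    let ?T = "{t \<in> {0..1}. h t \<in> path_image g}"
    have "compact ?T"
    proof -
      have "closed (path_image g)" using g(1) by (simp add: closed_arc_image)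
      then have "closed ({0..1} \<inter> h -` path_image g)"
        using continuous_closed_preimage[OF ch] by simp
      moreover have "?T = {0..1} \<inter> h -` path_image g" by auto
      ultimately have "closed ?T" by simp
      moreover have "bounded ?T" by (rule bounded_subset[of "{0..1}"]) auto
      ultimately show ?thesis by (simp add: compact_eq_bounded_closed)
    qed
    moreover have "1 \<in> ?T"
      using h(4) g(3) pathstart_in_path_image[of g] by (simp add: pathfinish_def)
    ultimately obtain t where t: "t \<in> ?T" and first: "\<And>s. s \<in> ?T \<Longrightarrow> t \<le> s"
      using compact_attains_inf[of ?T] by blast
    obtain r where r: "r \<in> {0..1}" "h t = g r" using t by (auto simp: path_image_def)
    have piece: "compact (f ` {l..u}) \<and> path_connected (f ` {l..u}) \<and> f ` {l..u} \<subseteq> B"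
      if "continuous_on {0..1} f" "f ` {0..1} \<subseteq> B" "0 \<le> l" "u \<le> 1" for f :: "real \<Rightarrow> complex" and l u
    proof -
      have sub: "{l..u} \<subseteq> {0..1}" using that by auto
      then have "continuous_on {l..u} f" using that(1) continuous_on_subset by blast
      then show ?thesis using sub that(2)
        by (intro conjI compact_continuous_image path_connected_continuous_image) 
           (auto simp: convex_imp_path_connected)
    qed
    have "h t \<in> h ` {0..t}" using t by auto
    have "\<forall>U\<in>{g ` {0..r}, g ` {r..1}, h ` {0..t}}.
        compact U \<and> path_connected U \<and> U \<subseteq> B \<and> h t \<in> U"
    proof
      fix U assume "U \<in> {g ` {0..r}, g ` {r..1}, h ` {0..t}}"
      then consider "U = g ` {0..r}" | "U = g ` {r..1}" | "U = h ` {0..t}" by blast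
      then show "compact U \<and> path_connected U \<and> U \<subseteq> B \<and> h t \<in> U"
      proof cases
        case 1
        then show ?thesis using piece[OF cg, of 0 r] r g(2) by (simp add: path_image_def)
      next
        case 2
        then show ?thesis using piece[OF cg, of r 1] r g(2) by (simp add: path_image_def)
      next
        case 3
        then show ?thesis using piece[OF ch, of 0 t] t h(2) by (simp add: path_image_def)
      qed
    qed
    moreover have "x 0 \<in> g ` {0..r}"
      using g(3) r imageI[of 0 "{0..r}" g] by (simp add: pathstart_def)
    moreover have "x 1 \<in> g ` {r..1}"
      using g(4) r imageI[of 1 "{r..1}" g] by (simp add: pathfinish_def)
    moreover have "x 2 \<in> h ` {0..t}"
      using h(3) t imageI[of 0 "{0..t}" h] by (simp add: pathstart_def)
    moreover have "g ` {0..r} \<inter> g ` {r..1} \<subseteq> {h t}"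
    proof clarsimp
      fix a b assume ab: "0 \<le> a" "a \<le> r" "r \<le> b" "b \<le> 1" "g a = g b"
      then have "a = b" using inj_onD[OF inj, of a b] r by auto
      then show "g b = h t" using ab r by simp
    qed
    moreover have hg: "h ` {0..t} \<inter> path_image g \<subseteq> {h t}"
    proof clarsimp
      fix s assume "0 \<le> s" "s \<le> t" "h s \<in> path_image g"
      then show "h s = h t" using first[of s] t by auto
    qed
    have gs: "g ` {0..r} \<subseteq> path_image g" "g ` {r..1} \<subseteq> path_image g"
      using r by (auto simp: path_image_def)
    have "g ` {0..r} \<inter> h ` {0..t} \<subseteq> {h t}" using hg gs(1) by blast
    moreover have "g ` {r..1} \<inter> h ` {0..t} \<subseteq> {h t}" using hg gs(2) by blast
    ultimately have "legs (h t) (g ` {0..r}) (g ` {r..1}) (h ` {0..t})"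
      unfolding legs_def by (intro conjI)
    then show ?thesis by blast
  qed
  then obtain y U0 U1 U2 where "legs y U0 U1 U2" by blast
  then have U:
    "\<forall>U\<in>{U0, U1, U2}. compact U \<and> path_connected U \<and> U \<subseteq> B \<and> y \<in> U"
    "x 0 \<in> U0 \<and> x 1 \<in> U1 \<and> x 2 \<in> U2" 
    "U0 \<inter> U1 \<subseteq> {y}" "U0 \<inter> U2 \<subseteq> {y}" "U1 \<inter> U2 \<subseteq> {y}"
    unfolding legs_def by blast+
  have less3: "i = 0 \<or> i = 1 \<or> i = 2" if "i < 3" for i :: nat using that by auto
  define V where "V i = (if i = 0 then U0 else if i = 1 then U1 else U2)" for i :: nat
  have "\<forall>i<3. compact (V i) \<and> path_connected (V i) \<and> V i \<subseteq> B \<and> x i \<in> V i \<and> y \<in> V i"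
    using U(1,2) less3 unfolding V_def by fastforce
  moreover have "\<forall>i<3. \<forall>j<3. i \<noteq> j \<longrightarrow> V i \<inter> V j \<subseteq> {y}"
  proof (intro allI impI)
    fix i j :: nat assume "i < 3" "j < 3" "i \<noteq> j"
    then show "V i \<inter> V j \<subseteq> {y}"
      using U(3-5) less3[of i] less3[of j] by (auto simp: V_def)
  qed
  ultimately show ?thesis by blast
qed

text \<open>Here \<open>A i\<close> and \<open>B j\<close> are the branch sets of a model of \<open>K\<^sub>3\<^sub>,\<^sub>3\<close>, and \<open>E i j\<close> is the drawn edge
  between them. Attaching to the legs of a tripod in \<open>B 0\<close> the edges \<open>E i 0\<close> gives a spider with
  feet in the sets \<open>A i\<close>, and \<open>B 1\<close> is treated likewise. An arc from the one centre to the other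
  through \<open>A i\<close>, for each \<open>i\<close>, completes a theta curve whose hub is any point of \<open>B 2\<close>.\<close>

lemma no_planar_K33_of_connected_sets:
  fixes A B :: "nat \<Rightarrow> complex set" and E :: "nat \<Rightarrow> nat \<Rightarrow> complex set"
  assumes A: "\<And>i. i < 3 \<Longrightarrow> path_connected (A i)"
    and B: "\<And>j. j < 3 \<Longrightarrow> path_connected (B j)"
    and E: "\<And>i j. i < 3 \<Longrightarrow> j < 3 \<Longrightarrow> compact (E i j) \<and> path_connected (E i j)"
    and AA: "\<And>i k. i < 3 \<Longrightarrow> k < 3 \<Longrightarrow> i \<noteq> k \<Longrightarrow> A i \<inter> A k = {}"
    and BB: "\<And>j l. j < 3 \<Longrightarrow> l < 3 \<Longrightarrow> j \<noteq> l \<Longrightarrow> B j \<inter> B l = {}"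
    and AB: "\<And>i j. i < 3 \<Longrightarrow> j < 3 \<Longrightarrow> A i \<inter> B j = {}"
    and EA: "\<And>i j. i < 3 \<Longrightarrow> j < 3 \<Longrightarrow> E i j \<inter> A i \<noteq> {}"
    and EB: "\<And>i j. i < 3 \<Longrightarrow> j < 3 \<Longrightarrow> \<exists>x. E i j \<inter> B j = {x}"
    and EA': "\<And>i j k. i < 3 \<Longrightarrow> j < 3 \<Longrightarrow> k < 3 \<Longrightarrow> k \<noteq> i \<Longrightarrow> E i j \<inter> A k = {}"
    and EB': "\<And>i j l. i < 3 \<Longrightarrow> j < 3 \<Longrightarrow> l < 3 \<Longrightarrow> l \<noteq> j \<Longrightarrow> E i j \<inter> B l = {}"
    and EE: "\<And>i j k l. i < 3 \<Longrightarrow> j < 3 \<Longrightarrow> k < 3 \<Longrightarrow> l < 3 \<Longrightarrow> (i, j) \<noteq> (k, l) \<Longrightarrow>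
               E i j \<inter> E k l \<subseteq> (if i = k then A i else if j = l then B j else {})"
  shows False
proof -
  define spider where "spider j y T \<longleftrightarrow> y \<in> B j \<and>
      (\<forall>i<3. compact (T i) \<and> path_connected (T i) \<and> y \<in> T i \<and>
             T i \<subseteq> B j \<union> E i j \<and> T i \<inter> A i \<noteq> {}) \<and>
      (\<forall>i<3. \<forall>k<3. i \<noteq> k \<longrightarrow> T i \<inter> T k \<subseteq> {y})" for j y T
  have spider: "\<exists>y T. spider j y T" if j: "j < 3" for j
  proof -
    have "\<forall>i\<in>{..<3}. \<exists>x. E i j \<inter> B j = {x}" using EB j by simp
    then obtain x where "\<forall>i\<in>{..<3}. E i j \<inter> B j = {x i}" by (rule bchoice[THEN exE])
    then have x: "\<And>i. i < 3 \<Longrightarrow> E i j \<inter> B j = {x i}" by simp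
    have xB: "x i \<in> B j" if "i < 3" for i using x[OF that] by blast
    obtain y U where tri:
      "\<forall>i<3. compact (U i) \<and> path_connected (U i) \<and> U i \<subseteq> B j \<and> x i \<in> U i \<and> y \<in> U i"
      "\<forall>i<3. \<forall>k<3. i \<noteq> k \<longrightarrow> U i \<inter> U k \<subseteq> {y}"
      using tripod[OF B[OF j], of x, OF xB] by blast
    have U: "compact (U i) \<and> path_connected (U i) \<and> U i \<subseteq> B j"
      and xy: "x i \<in> U i \<and> y \<in> U i" if "i < 3" for i
      using tri(1) that by blast+
    have UU: "U i \<inter> U k \<subseteq> {y}" if "i < 3" "k < 3" "i \<noteq> k" for i k
      using tri(2) that by blast
    show ?thesis unfolding spider_def
    proof (intro exI[of _ y] exI[of _ "\<lambda>i. U i \<union> E i j"] conjI allI impI)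
      show "y \<in> B j" using U[of 0] xy[of 0] by auto
    next
      fix i :: nat assume i: "i < 3"
      show "compact (U i \<union> E i j)" using U[OF i] E[OF i j] by (simp add: compact_Un)
      have "U i \<inter> E i j \<noteq> {}" using x[OF i] xy[OF i] by blast
      then show "path_connected (U i \<union> E i j)"
        using U[OF i] E[OF i j] by (intro path_connected_Un) auto
      show "y \<in> U i \<union> E i j" "U i \<union> E i j \<subseteq> B j \<union> E i j" "(U i \<union> E i j) \<inter> A i \<noteq> {}"
        using U[OF i] xy[OF i] EA[OF i j] by auto
    next
      fix i k :: nat assume ik: "i < 3" "k < 3" "i \<noteq> k"
      have "E i j \<inter> E k j \<subseteq> B j" using EE[of i j k j] ik j by auto
      then have "(U i \<union> E i j) \<inter> (U k \<union> E k j) \<subseteq> B j"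
        using U[OF ik(1)] U[OF ik(2)] by auto
      moreover have "(U i \<union> E i j) \<inter> B j \<subseteq> U i" "(U k \<union> E k j) \<inter> B j \<subseteq> U k"
        using x[OF ik(1)] x[OF ik(2)] xy[OF ik(1)] xy[OF ik(2)]
        by (simp_all add: Int_Un_distrib2)
      ultimately have "(U i \<union> E i j) \<inter> (U k \<union> E k j) \<subseteq> U i \<inter> U k" by auto
      then show "(U i \<union> E i j) \<inter> (U k \<union> E k j) \<subseteq> {y}" using UU ik by blast
    qed
  qed
  obtain a S where "spider 0 a S" using spider[of 0] by auto
  then have a: "a \<in> B 0"
    and S: "\<And>i. i < 3 \<Longrightarrow> compact (S i) \<and> path_connected (S i) \<and> a \<in> S i \<and>
              S i \<subseteq> B 0 \<union> E i 0 \<and> S i \<inter> A i \<noteq> {}"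
    and SS: "\<And>i k. i < 3 \<Longrightarrow> k < 3 \<Longrightarrow> i \<noteq> k \<Longrightarrow> S i \<inter> S k \<subseteq> {a}"
    unfolding spider_def by blast+
  obtain b T where "spider 1 b T" using spider[of 1] by auto
  then have b: "b \<in> B 1"
    and T: "\<And>i. i < 3 \<Longrightarrow> compact (T i) \<and> path_connected (T i) \<and> b \<in> T i \<and>
              T i \<subseteq> B 1 \<union> E i 1 \<and> T i \<inter> A i \<noteq> {}"
    and TT: "\<And>i k. i < 3 \<Longrightarrow> k < 3 \<Longrightarrow> i \<noteq> k \<Longrightarrow> T i \<inter> T k \<subseteq> {b}"
    unfolding spider_def by blast+
  define X where "X i = S i \<union> A i \<union> T i" for i
  have "a \<noteq> b" using a b BB[of 0 1] by auto
  have "\<exists>g. arc g \<and> path_image g \<subseteq> X i \<and> pathstart g = a \<and> pathfinish g = b" if i: "i < 3" for i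
  proof -
    have "path_connected (S i \<union> A i)"
      using S[OF i] A[OF i] by (intro path_connected_Un) auto
    then have "path_connected (X i)"
      unfolding X_def using T[OF i] by (intro path_connected_Un[of "S i \<union> A i"]) auto
    then show ?thesis
      using S[OF i] T[OF i] \<open>a \<noteq> b\<close> unfolding path_connected_arcwise X_def by blast
  qed
  then obtain P where P: "\<And>i. i < 3 \<Longrightarrow> arc (P i)" "\<And>i. i < 3 \<Longrightarrow> path_image (P i) \<subseteq> X i"
    "\<And>i. i < 3 \<Longrightarrow> pathstart (P i) = a" "\<And>i. i < 3 \<Longrightarrow> pathfinish (P i) = b" by metis
  have ends: "a \<in> path_image (P i)" "b \<in> path_image (P i)" if "i < 3" for i
    using P(3,4)[OF that] by (auto simp: pathstart_in_path_image pathfinish_in_path_image)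
  have SA: "S i \<inter> A k = {}" and TA: "T i \<inter> A k = {}" and ST: "S i \<inter> T k = {}"
    if ik: "i < 3" "k < 3" "i \<noteq> k" for i k
  proof -
    show "S i \<inter> A k = {}" using S[of i] AB[of k 0] EA'[of i 0 k] ik by auto
    show "T i \<inter> A k = {}" using T[of i] AB[of k 1] EA'[of i 1 k] ik by auto
    have "S i \<subseteq> B 0 \<union> E i 0" "T k \<subseteq> B 1 \<union> E k 1" using S T ik by auto
    moreover have "B 0 \<inter> B 1 = {}" "B 0 \<inter> E k 1 = {}" "E i 0 \<inter> B 1 = {}" "E i 0 \<inter> E k 1 = {}"
      using BB[of 0 1] EB'[of k 1 0] EB'[of i 0 1] EE[of i 0 k 1] ik by auto
    ultimately show "S i \<inter> T k = {}" by blast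
  qed
  have XX: "X i \<inter> X k \<subseteq> {a, b}" if ik: "i < 3" "k < 3" "i \<noteq> k" for i k
    using SS[OF ik] TT[OF ik] AA[OF ik] SA[OF ik] TA[OF ik] ST[OF ik]
      SA[of k i] TA[of k i] ST[of k i] ik unfolding X_def by blast
  define C where "C k = B 2 \<union> E k 2 \<union> A k" for k
  have con: "connected (C k)" if k: "k < 3" for k
  proof -
    have "B 2 \<inter> E k 2 \<noteq> {}" using EB[OF k, of 2] by fastforce
    then have "path_connected (B 2 \<union> E k 2)"
      using B[of 2] E[OF k, of 2] by (intro path_connected_Un) auto
    then have "path_connected (C k)"
      unfolding C_def using A[OF k] EA[OF k, of 2] by (intro path_connected_Un[of "B 2 \<union> E k 2"]) auto
    then show ?thesis by (rule path_connected_imp_connected)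
  qed
  have CX: "C k \<inter> X i = {}" if ik: "i < 3" "k < 3" "i \<noteq> k" for i k
  proof -
    have "(B 2 \<union> E k 2) \<inter> (B 0 \<union> E i 0) = {}"
      using BB[of 2 0] EB'[of i 0 2] EB'[of k 2 0] EE[of k 2 i 0] ik by auto
    moreover have "(B 2 \<union> E k 2) \<inter> (B 1 \<union> E i 1) = {}"
      using BB[of 2 1] EB'[of i 1 2] EB'[of k 2 1] EE[of k 2 i 1] ik by auto
    moreover have "S i \<subseteq> B 0 \<union> E i 0" "T i \<subseteq> B 1 \<union> E i 1"
      using S[OF ik(1)] T[OF ik(1)] by auto
    ultimately have "(B 2 \<union> E k 2) \<inter> (S i \<union> T i) = {}" by blast
    moreover have "(B 2 \<union> E k 2) \<inter> A i = {}"
      using AB[of i 2] EA'[of k 2 i] ik by auto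
    moreover have "A k \<inter> X i = {}"
      using SA[OF ik] TA[OF ik] AA[OF ik] unfolding X_def by blast
    ultimately show ?thesis unfolding C_def X_def by blast
  qed
  \<comment> \<open>An arc missing \<open>A k\<close> would be covered by two closed sets, the legs of both spiders, that are
    disjoint on it.\<close>
  have meets: "C k \<inter> path_image (P k) \<noteq> {}" if k: "k < 3" for k
  proof
    assume no: "C k \<inter> path_image (P k) = {}"
    have "S k \<inter> T k \<subseteq> A k"
    proof -
      have "S k \<subseteq> B 0 \<union> E k 0" "T k \<subseteq> B 1 \<union> E k 1" using S T k by auto
      moreover have "B 0 \<inter> B 1 = {}" "B 0 \<inter> E k 1 = {}" "E k 0 \<inter> B 1 = {}" "E k 0 \<inter> E k 1 \<subseteq> A k"
        using BB[of 0 1] EB'[of k 1 0] EB'[of k 0 1] EE[of k 0 k 1] k by auto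
      ultimately show ?thesis by blast
    qed
    then have "S k \<inter> T k \<inter> path_image (P k) = {}" "path_image (P k) \<subseteq> S k \<union> T k"
      using no P(2)[OF k] by (auto simp: C_def X_def)
    moreover have "closed (S k)" "closed (T k)" using S[OF k] T[OF k] by (auto simp: compact_imp_closed)
    moreover have "connected (path_image (P k))" using P(1)[OF k] by (simp add: connected_arc_image)
    ultimately have "S k \<inter> path_image (P k) = {} \<or> T k \<inter> path_image (P k) = {}"
      by (metis connected_closedD)
    then show False using S[OF k] T[OF k] ends[OF k] by blast
  qed
  obtain p where "p \<in> B 2" using EB[of 0 2] by fastforce
  show False
  proof (rule theta_curve_hub[of P a b C p])
    fix i k :: nat assume ik: "i < 3" "k < 3" "i \<noteq> k"
    then show "path_image (P i) \<inter> path_image (P k) = {a, b}"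
      using P(2)[of i] P(2)[of k] XX[of i k] ends[of i] ends[of k] by blast
    show "C k \<inter> path_image (P i) = {}" using CX[OF ik] P(2)[of i] ik by blast
  qed (use P con meets \<open>p \<in> B 2\<close> in \<open>auto simp: C_def\<close>)
qed
section \<open>Minor models\<close>

definition connected_in :: "'a graph \<Rightarrow> 'a set \<Rightarrow> bool" where
  "connected_in G X \<longleftrightarrow> X \<noteq> {} \<and> X \<subseteq> verts G \<and>
     (\<forall>x\<in>X. \<forall>y\<in>X. (x, y) \<in> {(u, v). u \<in> X \<and> v \<in> X \<and> {u, v} \<in> edges G}\<^sup>*)"

definition minor_model :: "'b graph \<Rightarrow> 'a graph \<Rightarrow> ('b \<Rightarrow> 'a set) \<Rightarrow> bool" where
  "minor_model H G \<beta> \<longleftrightarrow>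
     (\<forall>x\<in>verts H. connected_in G (\<beta> x)) \<and>
     (\<forall>x\<in>verts H. \<forall>y\<in>verts H. x \<noteq> y \<longrightarrow> \<beta> x \<inter> \<beta> y = {}) \<and>
     (\<forall>x\<in>verts H. \<forall>y\<in>verts H. {x, y} \<in> edges H \<longrightarrow>
        (\<exists>u\<in>\<beta> x. \<exists>v\<in>\<beta> y. {u, v} \<in> edges G))"

definition minor_free :: "'b graph \<Rightarrow> 'a graph set" where
  "minor_free H = {G. simple_graph G \<and> (\<nexists>\<beta>. minor_model H G \<beta>)}"

lemma connected_inD:
  assumes "connected_in G X"
  shows "X \<noteq> {}" "X \<subseteq> verts G"
    and "x \<in> X \<Longrightarrow> y \<in> X \<Longrightarrow> (x, y) \<in> {(u, v). u \<in> X \<and> v \<in> X \<and> {u, v} \<in> edges G}\<^sup>*"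
  using assms by (simp_all add: connected_in_def)

lemma connected_in_singleton: "v \<in> verts G \<Longrightarrow> connected_in G {v}"
  by (simp add: connected_in_def)

lemma connected_in_UN:
  assumes X: "connected_in K X"
    and \<gamma>: "\<And>a. a \<in> X \<Longrightarrow> connected_in G (\<gamma> a)"
    and edge: "\<And>a b. a \<in> X \<Longrightarrow> b \<in> X \<Longrightarrow> {a, b} \<in> edges K \<Longrightarrow>
                 \<exists>p\<in>\<gamma> a. \<exists>q\<in>\<gamma> b. {p, q} \<in> edges G"
  shows "connected_in G (\<Union>a\<in>X. \<gamma> a)"
proof -
  let ?U = "\<Union>a\<in>X. \<gamma> a"
  let ?R = "{(u, v). u \<in> ?U \<and> v \<in> ?U \<and> {u, v} \<in> edges G}"
  have inner: "(x, y) \<in> ?R\<^sup>*" if "a \<in> X" "x \<in> \<gamma> a" "y \<in> \<gamma> a" for a x y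
  proof -
    have "(x, y) \<in> {(u, v). u \<in> \<gamma> a \<and> v \<in> \<gamma> a \<and> {u, v} \<in> edges G}\<^sup>*"
      using connected_inD(3)[OF \<gamma>[OF that(1)] that(2,3)] .
    moreover have "{(u, v). u \<in> \<gamma> a \<and> v \<in> \<gamma> a \<and> {u, v} \<in> edges G} \<subseteq> ?R"
      using that(1) by blast
    ultimately show ?thesis using rtrancl_mono by blast
  qed
  have reach: "\<forall>x\<in>\<gamma> a. \<forall>y\<in>\<gamma> b. (x, y) \<in> ?R\<^sup>*"
    if "(a, b) \<in> {(u, v). u \<in> X \<and> v \<in> X \<and> {u, v} \<in> edges K}\<^sup>*" "a \<in> X" for a b
    using that
  proof (induction rule: rtrancl_induct)
    case base
    then show ?case using inner[of a] by blast
  next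
    case (step b c)
    then have bc: "b \<in> X" "c \<in> X" "{b, c} \<in> edges K" by auto
    obtain p q where pq: "p \<in> \<gamma> b" "q \<in> \<gamma> c" "{p, q} \<in> edges G"
      using edge[OF bc] by blast
    show ?case
    proof (intro ballI)
      fix x y assume xy: "x \<in> \<gamma> a" "y \<in> \<gamma> c"
      have "(x, p) \<in> ?R\<^sup>*" using step.IH[OF step.prems] xy(1) pq(1) by blast
      moreover have "(p, q) \<in> ?R" using pq bc by blast
      moreover have "(q, y) \<in> ?R\<^sup>*" using inner[OF bc(2) pq(2) xy(2)] .
      ultimately show "(x, y) \<in> ?R\<^sup>*" by (rule rtrancl_trans[OF rtrancl_into_rtrancl])
    qed
  qed
  have "?U \<noteq> {}" using connected_inD(1)[OF X] connected_inD(1)[OF \<gamma>] by simp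
  moreover have "?U \<subseteq> verts G" using connected_inD(2)[OF \<gamma>] by (rule UN_least)
  moreover have "(x, y) \<in> ?R\<^sup>*" if xy: "x \<in> ?U" "y \<in> ?U" for x y
  proof -
    obtain a b where ab: "a \<in> X" "b \<in> X" "x \<in> \<gamma> a" "y \<in> \<gamma> b" using xy by blast
    then have "(a, b) \<in> {(u, v). u \<in> X \<and> v \<in> X \<and> {u, v} \<in> edges K}\<^sup>*"
      using connected_inD(3)[OF X] by simp
    then show ?thesis using reach[of a b] ab by blast
  qed
  ultimately show ?thesis by (simp add: connected_in_def)
qed

lemma minor_modelD:
  assumes "minor_model H G \<beta>"
  shows "x \<in> verts H \<Longrightarrow> connected_in G (\<beta> x)"
    and "x \<in> verts H \<Longrightarrow> y \<in> verts H \<Longrightarrow> x \<noteq> y \<Longrightarrow> \<beta> x \<inter> \<beta> y = {}"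
    and "x \<in> verts H \<Longrightarrow> y \<in> verts H \<Longrightarrow> {x, y} \<in> edges H \<Longrightarrow>
           \<exists>u\<in>\<beta> x. \<exists>v\<in>\<beta> y. {u, v} \<in> edges G"
  using assms by (simp_all add: minor_model_def)

text \<open>This single fact makes excluding a minor stable under all minor operations and under
  isomorphism: it suffices that each of them has a model of its result in the original graph.\<close>

lemma minor_model_trans:
  assumes \<beta>: "minor_model H K \<beta>" and \<gamma>: "minor_model K G \<gamma>"
  shows "minor_model H G (\<lambda>x. \<Union>a\<in>\<beta> x. \<gamma> a)"
proof -
  have sub: "a \<in> verts K" if "x \<in> verts H" "a \<in> \<beta> x" for x a
    using connected_inD(2)[OF minor_modelD(1)[OF \<beta> that(1)]] that(2) by blast
  show ?thesis
    unfolding minor_model_def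
  proof (intro conjI ballI impI)
    fix x assume x: "x \<in> verts H"
    show "connected_in G (\<Union>a\<in>\<beta> x. \<gamma> a)"
    proof (rule connected_in_UN)
      show "connected_in K (\<beta> x)" using minor_modelD(1)[OF \<beta> x] .
    next
      fix a assume "a \<in> \<beta> x"
      then show "connected_in G (\<gamma> a)" using minor_modelD(1)[OF \<gamma> sub[OF x]] by simp
    next
      fix a b assume "a \<in> \<beta> x" "b \<in> \<beta> x" "{a, b} \<in> edges K"
      then show "\<exists>p\<in>\<gamma> a. \<exists>q\<in>\<gamma> b. {p, q} \<in> edges G"
        using minor_modelD(3)[OF \<gamma> sub[OF x] sub[OF x]] by simp
    qed
  next
    fix x y assume xy: "x \<in> verts H" "y \<in> verts H" "x \<noteq> y"
    have "\<gamma> a \<inter> \<gamma> b = {}" if ab: "a \<in> \<beta> x" "b \<in> \<beta> y" for a b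
    proof -
      have "a \<noteq> b" using minor_modelD(2)[OF \<beta> xy] ab by blast
      then show ?thesis using minor_modelD(2)[OF \<gamma> sub[OF xy(1) ab(1)] sub[OF xy(2) ab(2)]] by simp
    qed
    then show "(\<Union>a\<in>\<beta> x. \<gamma> a) \<inter> (\<Union>a\<in>\<beta> y. \<gamma> a) = {}" by blast
  next
    fix x y assume xy: "x \<in> verts H" "y \<in> verts H" "{x, y} \<in> edges H"
    obtain a b where ab: "a \<in> \<beta> x" "b \<in> \<beta> y" "{a, b} \<in> edges K"
      using minor_modelD(3)[OF \<beta> xy] by blast
    obtain u v where "u \<in> \<gamma> a" "v \<in> \<gamma> b" "{u, v} \<in> edges G"
      using minor_modelD(3)[OF \<gamma> sub[OF xy(1) ab(1)] sub[OF xy(2) ab(2)] ab(3)] by blast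
    then show "\<exists>u\<in>\<Union>a\<in>\<beta> x. \<gamma> a. \<exists>v\<in>\<Union>a\<in>\<beta> y. \<gamma> a. {u, v} \<in> edges G"
      using ab by blast
  qed
qed

lemma minor_model_embedding:
  assumes "inj_on f (verts H)" "f ` verts H \<subseteq> verts G"
    and "\<And>e. e \<in> edges H \<Longrightarrow> f ` e \<in> edges G"
  shows "minor_model H G (\<lambda>x. {f x})"
  unfolding minor_model_def
proof (intro conjI ballI impI)
  fix x assume "x \<in> verts H"
  then show "connected_in G {f x}" using assms(2) by (auto intro: connected_in_singleton)
next
  fix x y assume "x \<in> verts H" "y \<in> verts H" "x \<noteq> y"
  then show "{f x} \<inter> {f y} = {}" using assms(1) by (auto simp: inj_on_def)
next
  fix x y assume "{x, y} \<in> edges H"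
  then show "\<exists>u\<in>{f x}. \<exists>v\<in>{f y}. {u, v} \<in> edges G" using assms(3)[of "{x, y}"] by simp
qed

lemma minor_model_contract_edge:
  assumes G: "simple_graph G" and uv: "{u, v} \<in> edges G"
  shows "minor_model (contract_edge G u v) G (\<lambda>a. if a = u then {u, v} else {a})"
proof -
  let ?\<phi> = "\<lambda>x. if x = v then u else x" and ?\<gamma> = "\<lambda>a. if a = u then {u, v} else {a}"
  have uvG: "u \<in> verts G" "v \<in> verts G" "u \<noteq> v"
    using G uv unfolding simple_graph_def by fastforce+
  have swap: "{v, u} \<in> edges G" using uv by (simp add: insert_commute)
  have V: "verts (contract_edge G u v) = verts G - {v}" by (simp add: contract_edge_def)
  show ?thesis
    unfolding minor_model_def
  proof (intro conjI ballI impI)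
    fix x assume "x \<in> verts (contract_edge G u v)"
    moreover have "connected_in G {u, v}"
      unfolding connected_in_def using uvG uv swap by (auto intro!: r_into_rtrancl)
    ultimately show "connected_in G (?\<gamma> x)" using V by (auto intro: connected_in_singleton)
  next
    fix x y assume "x \<in> verts (contract_edge G u v)" "y \<in> verts (contract_edge G u v)" "x \<noteq> y"
    then show "?\<gamma> x \<inter> ?\<gamma> y = {}" using V by auto
  next
    fix x y assume "{x, y} \<in> edges (contract_edge G u v)"
    then obtain f where f: "f \<in> edges G" "{x, y} = ?\<phi> ` f"
      unfolding contract_edge_def by auto
    have "card f = 2" using G f(1) by (simp add: simple_graph_def)
    then obtain p q where pq: "f = {p, q}" by (auto simp: card_2_iff)
    have mem: "p \<in> ?\<gamma> (?\<phi> p)" for p by auto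
    have "(x = ?\<phi> p \<and> y = ?\<phi> q) \<or> (x = ?\<phi> q \<and> y = ?\<phi> p)"
      using f(2) unfolding pq by (simp only: image_insert image_empty doubleton_eq_iff)
    moreover have "{p, q} \<in> edges G" "{q, p} \<in> edges G"
      using f(1) pq by (simp_all add: insert_commute)
    ultimately show "\<exists>a\<in>?\<gamma> x. \<exists>b\<in>?\<gamma> y. {a, b} \<in> edges G"
      using mem by blast
  qed
qed

lemma simple_graph_contract_edge:
  assumes "simple_graph G" "{u, v} \<in> edges G"
  shows "simple_graph (contract_edge G u v)"
proof -
  have "u \<in> verts G" "u \<noteq> v" using assms unfolding simple_graph_def by fastforce+
  then show ?thesis
    using assms(1) unfolding simple_graph_def contract_edge_def by auto
qed

lemma minor_free_model: "G \<in> minor_free H \<Longrightarrow> minor_model K G \<gamma> \<Longrightarrow> simple_graph K \<Longrightarrow> K \<in> minor_free H"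
  unfolding minor_free_def using minor_model_trans by blast

lemma graph_class_minor_free: "graph_class (minor_free H)"
  unfolding graph_class_def
proof (intro conjI ballI allI impI)
  fix G :: "'a graph" assume "G \<in> minor_free H"
  then show "simple_graph G" by (simp add: minor_free_def)
next
  fix G K :: "'a graph" assume G: "G \<in> minor_free H" and K: "simple_graph K \<and> isomorphic G K"
  then obtain f where f: "bij_betw f (verts G) (verts K)" "(\<lambda>e. f ` e) ` edges G = edges K"
    unfolding isomorphic_def by blast
  let ?g = "inv_into (verts G) f"
  have "minor_model K G (\<lambda>x. {?g x})"
  proof (rule minor_model_embedding)
    have "bij_betw ?g (verts K) (verts G)" using f(1) by (rule bij_betw_inv_into)
    then show "inj_on ?g (verts K)" "?g ` verts K \<subseteq> verts G" by (auto simp: bij_betw_def)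
  next
    fix e assume "e \<in> edges K"
    then obtain d where d: "d \<in> edges G" "e = f ` d" using f(2) by blast
    have "d \<subseteq> verts G" using d(1) G by (auto simp: minor_free_def simple_graph_def)
    then have "?g ` e = d"
      using f(1) d(2) by (simp add: bij_betw_def inv_into_image_cancel)
    then show "?g ` e \<in> edges G" using d(1) by simp
  qed
  then show "K \<in> minor_free H" using minor_free_model G K by blast
qed

lemma minor_closed_minor_free: "minor_closed (minor_free H)"
  unfolding minor_closed_def
proof (intro conjI ballI allI impI)
  fix G :: "'a graph" assume G: "G \<in> minor_free H"
  then have simple: "simple_graph G" by (simp add: minor_free_def)
  have sub: "K \<in> minor_free H"
    if "simple_graph K" "verts K \<subseteq> verts G" "edges K \<subseteq> edges G" for K
    by (rule minor_free_model[OF G minor_model_embedding[of "\<lambda>x. x"]]) (use that in auto)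
  show "delete_vertex G v \<in> minor_free H" for v
    by (rule sub) (use simple in \<open>auto simp: simple_graph_def delete_vertex_def\<close>)
  show "delete_edge G e \<in> minor_free H" for e
    by (rule sub) (use simple in \<open>auto simp: simple_graph_def delete_edge_def\<close>)
  show "contract_edge G u v \<in> minor_free H" if "{u, v} \<in> edges G" for u v
    using minor_free_model[OF G] minor_model_contract_edge[OF simple that]
      simple_graph_contract_edge[OF simple that] by blast
qed

lemma proper_class_minor_free:
  assumes H: "simple_graph H"
  shows "proper_class (minor_free H :: 'a :: infinite graph set)"
proof -
  obtain T :: "'a set" where T: "finite T" "card T = card (verts H)"
    using infinite_arbitrarily_large[OF infinite_UNIV] by blast
  have "finite (verts H)" using H by (simp add: simple_graph_def)
  then obtain f where f: "bij_betw f (verts H) T"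
    using T finite_same_card_bij by metis
  define G where "G = (f ` verts H, (\<lambda>e. f ` e) ` edges H)"
  have inj: "inj_on f (verts H)" using f by (simp add: bij_betw_def)
  have "simple_graph G"
    unfolding simple_graph_def
  proof (intro conjI ballI)
    show "finite (verts G)" using \<open>finite (verts H)\<close> by (simp add: G_def)
  next
    fix e assume "e \<in> edges G"
    then obtain d where d: "d \<in> edges H" "e = f ` d" by (auto simp: G_def)
    then have "d \<subseteq> verts H" "card d = 2" using H by (auto simp: simple_graph_def)
    then show "e \<subseteq> verts G" "card e = 2"
      using d inj by (auto simp: G_def card_image inj_on_subset)
  qed
  moreover have "minor_model H G (\<lambda>x. {f x})"
    using inj by (intro minor_model_embedding) (auto simp: G_def)
  ultimately show ?thesis unfolding proper_class_def minor_free_def by blast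
qed

section \<open>Crossings forced by disjoint copies of the excluded graph\<close>

text \<open>In a vertex \<open>(t, b, i)\<close> the number \<open>t\<close> selects the copy and \<open>b\<close> the side of the bipartition.\<close>

definition copies_K33 :: "nat \<Rightarrow> (nat \<times> bool \<times> nat) graph" where
  "copies_K33 n = ({..<n} \<times> UNIV \<times> {..<3},
     {{(t, False, i), (t, True, j)} |t i j. t < n \<and> i < 3 \<and> j < 3})"

lemma simple_graph_copies_K33: "simple_graph (copies_K33 n)"
  by (auto simp: simple_graph_def copies_K33_def)

definition drawn_region ::
    "'a graph \<Rightarrow> ('a \<Rightarrow> complex) \<Rightarrow> ('a set \<Rightarrow> real \<Rightarrow> complex) \<Rightarrow> 'a set \<Rightarrow> complex set" where
  "drawn_region G pos \<gamma> X = pos ` X \<union> (\<Union>e\<in>{e \<in> edges G. e \<subseteq> X}. path_image (\<gamma> e))"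

lemma drawing_edge:
  assumes "is_drawing G pos \<gamma>" "e \<in> edges G"
  shows "arc (\<gamma> e)" "pos ` e \<subseteq> path_image (\<gamma> e)"
proof -
  show "arc (\<gamma> e)" using assms by (simp add: is_drawing_def)
  have "pos ` e = {pathstart (\<gamma> e), pathfinish (\<gamma> e)}"
    using assms by (simp add: is_drawing_def)
  then show "pos ` e \<subseteq> path_image (\<gamma> e)"
    by (simp add: pathstart_in_path_image pathfinish_in_path_image)
qed

lemma path_connected_drawn_region:
  assumes G: "simple_graph G" and D: "is_drawing G pos \<gamma>" and X: "connected_in G X"
  shows "path_connected (drawn_region G pos \<gamma> X)"
proof -
  let ?S = "drawn_region G pos \<gamma> X"
  have along: "path_component ?S x y"
    if e: "e \<in> edges G" "e \<subseteq> X" and "x \<in> path_image (\<gamma> e)" "y \<in> path_image (\<gamma> e)" for e x y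
  proof -
    have "path_connected (path_image (\<gamma> e))"
      using drawing_edge(1)[OF D e(1)] by (simp add: arc_imp_path path_connected_path_image)
    then have "path_component (path_image (\<gamma> e)) x y"
      using that by (simp add: path_connected_component)
    moreover have "path_image (\<gamma> e) \<subseteq> ?S" using e by (auto simp: drawn_region_def)
    ultimately show ?thesis by (rule path_component_of_subset[rotated])
  qed
  have in_S: "pos u \<in> ?S" if "u \<in> X" for u using that by (auto simp: drawn_region_def)
  have verts: "path_component ?S (pos u) (pos v)" if "u \<in> X" "v \<in> X" for u v
  proof -
    have "(u, v) \<in> {(u, v). u \<in> X \<and> v \<in> X \<and> {u, v} \<in> edges G}\<^sup>*"
      using connected_inD(3)[OF X that] .
    then show ?thesis
    proof (induction rule: rtrancl_induct)
      case base
      then show ?case using in_S that(1) by (simp add: path_component_refl)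
    next
      case (step v w)
      then have "{v, w} \<in> edges G" "{v, w} \<subseteq> X" by auto
      then have "path_component ?S (pos v) (pos w)"
        using drawing_edge(2)[OF D, of "{v, w}"] by (intro along[of "{v, w}"]) auto
      then show ?case using step.IH path_component_trans by blast
    qed
  qed
  have to_vertex: "\<exists>u\<in>X. path_component ?S x (pos u)" if x: "x \<in> ?S" for x
  proof (cases "x \<in> pos ` X")
    case True
    then show ?thesis using in_S path_component_refl by blast
  next
    case False
    then obtain e where e: "e \<in> edges G" "e \<subseteq> X" "x \<in> path_image (\<gamma> e)"
      using x by (auto simp: drawn_region_def)
    have "card e = 2" using G e(1) by (simp add: simple_graph_def)
    then obtain u where "u \<in> e" by fastforce
    then show ?thesis using along[OF e(1,2,3)] drawing_edge(2)[OF D e(1)] e(2) by blast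
  qed
  show ?thesis
    unfolding path_connected_component
    by (meson to_vertex verts path_component_trans path_component_sym)
qed

text \<open>Without a crossing, regions drawn for disjoint vertex sets are disjoint, and an edge meets the
  region of a set not containing it at most in its endpoints. Hence the drawn regions of the
  branch sets together with one edge for each pair would contradict
  \<open>no_planar_K33_of_connected_sets\<close>.\<close>

lemma crossing_in_K33_model:
  fixes A B :: "nat \<Rightarrow> 'a set"
  assumes G: "simple_graph G" and D: "is_drawing G pos \<gamma>"
    and A: "\<And>i. i < 3 \<Longrightarrow> connected_in G (A i)"
    and B: "\<And>j. j < 3 \<Longrightarrow> connected_in G (B j)"
    and AA: "\<And>i k. i < 3 \<Longrightarrow> k < 3 \<Longrightarrow> i \<noteq> k \<Longrightarrow> A i \<inter> A k = {}"
    and BB: "\<And>j l. j < 3 \<Longrightarrow> l < 3 \<Longrightarrow> j \<noteq> l \<Longrightarrow> B j \<inter> B l = {}"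
    and AB: "\<And>i j. i < 3 \<Longrightarrow> j < 3 \<Longrightarrow> A i \<inter> B j = {}"
    and E: "\<And>i j. i < 3 \<Longrightarrow> j < 3 \<Longrightarrow> \<exists>u\<in>A i. \<exists>v\<in>B j. {u, v} \<in> edges G"
  shows "\<exists>e\<in>edges G. \<exists>f\<in>edges G. e \<noteq> f \<and> e \<union> f \<subseteq> (\<Union>i<3. A i \<union> B i) \<and>
           path_image (\<gamma> e) \<inter> path_image (\<gamma> f) - pos ` (e \<inter> f) \<noteq> {}"
proof (rule ccontr)
  assume neg: "\<not> ?thesis"
  define V where "V = (\<Union>i<3. A i \<union> B i)"
  have nocross: "path_image (\<gamma> e) \<inter> path_image (\<gamma> f) \<subseteq> pos ` (e \<inter> f)"
    if "e \<in> edges G" "f \<in> edges G" "e \<noteq> f" "e \<subseteq> V" "f \<subseteq> V" for e f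
    using neg that unfolding V_def by blast
  have AV: "A i \<subseteq> V" "B i \<subseteq> V" if "i < 3" for i using that by (auto simp: V_def)
  have V: "V \<subseteq> verts G"
    unfolding V_def using connected_inD(2)[OF A] connected_inD(2)[OF B] by (intro UN_least Un_least) auto
  let ?R = "drawn_region G pos \<gamma>"
  have vertex: "v \<in> e" if "e \<in> edges G" "v \<in> verts G" "pos v \<in> path_image (\<gamma> e)" for e v
    using D that by (simp add: is_drawing_def)
  have region_edge: "?R X \<inter> path_image (\<gamma> e) \<subseteq> pos ` (X \<inter> e)"
    if "e \<in> edges G" "e \<subseteq> V" "X \<subseteq> V" "\<not> e \<subseteq> X" for X e
  proof
    fix z assume z: "z \<in> ?R X \<inter> path_image (\<gamma> e)"
    then consider v where "v \<in> X" "z = pos v" | f where "f \<in> edges G" "f \<subseteq> X" "z \<in> path_image (\<gamma> f)"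
      by (auto simp: drawn_region_def)
    then show "z \<in> pos ` (X \<inter> e)"
    proof cases
      case 1
      then show ?thesis using vertex[of e v] that V z by auto
    next
      case 2
      then have "z \<in> pos ` (f \<inter> e)" using nocross[of f e] that z by auto
      then show ?thesis using 2 by auto
    qed
  qed
  have region_disj: "?R X \<inter> ?R Y = {}" if XY: "X \<subseteq> V" "Y \<subseteq> V" "X \<inter> Y = {}" for X Y
  proof (rule ccontr)
    assume "?R X \<inter> ?R Y \<noteq> {}"
    then obtain z where z: "z \<in> ?R X" "z \<in> ?R Y" by blast
    from z(2) consider v where "v \<in> Y" "z = pos v" | e where "e \<in> edges G" "e \<subseteq> Y" "z \<in> path_image (\<gamma> e)"
      by (auto simp: drawn_region_def)
    then show False
    proof cases
      case 1
      from z(1) consider u where "u \<in> X" "z = pos u" | f where "f \<in> edges G" "f \<subseteq> X" "z \<in> path_image (\<gamma> f)"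
        by (auto simp: drawn_region_def)
      then show False
      proof cases
        case (1 u)
        have "inj_on pos (verts G)" using D by (simp add: is_drawing_def)
        moreover have "u \<in> verts G" "v \<in> verts G" "pos u = pos v"
          using 1 \<open>z = pos v\<close> \<open>v \<in> Y\<close> XY V by auto
        ultimately have "u = v" by (simp add: inj_on_eq_iff)
        then show False using 1 \<open>v \<in> Y\<close> XY by blast
      next
        case (2 f)
        then have "v \<in> f" using vertex[of f v] 1 XY V by auto
        then show False using 1 2 XY by blast
      qed
    next
      case (2 e)
      have "card e = 2" using G 2(1) by (simp add: simple_graph_def)
      then have "\<not> e \<subseteq> X" using 2 XY by (auto simp: card_2_iff)
      then have "z \<in> pos ` (X \<inter> e)" using region_edge[of e X] 2 z XY by blast
      then show False using 2 XY by blast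
    qed
  qed
  obtain u v where uv: "\<And>i j. i < 3 \<Longrightarrow> j < 3 \<Longrightarrow> u i j \<in> A i \<and> v i j \<in> B j \<and> {u i j, v i j} \<in> edges G"
    using E by metis
  define s where "s i j = {u i j, v i j}" for i j
  have s: "s i j \<in> edges G" "s i j \<subseteq> V" "pos (u i j) \<in> path_image (\<gamma> (s i j))"
      "pos (v i j) \<in> path_image (\<gamma> (s i j))" "\<not> s i j \<subseteq> A k" "\<not> s i j \<subseteq> B k"
      "s i j \<inter> A k = (if k = i then {u i j} else {})" "s i j \<inter> B k = (if k = j then {v i j} else {})"
    if "i < 3" "j < 3" "k < 3" for i j k
  proof -
    show e: "s i j \<in> edges G" using uv that by (simp add: s_def)
    show "s i j \<subseteq> V" using uv[of i j] AV that by (auto simp: s_def)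
    show "pos (u i j) \<in> path_image (\<gamma> (s i j))" "pos (v i j) \<in> path_image (\<gamma> (s i j))"
      using drawing_edge(2)[OF D e] by (auto simp: s_def)
    show "s i j \<inter> A k = (if k = i then {u i j} else {})"
      using uv[of i j] AA[of i k] AB[of k j] that by (auto simp: s_def)
    show "s i j \<inter> B k = (if k = j then {v i j} else {})"
      using uv[of i j] BB[of j k] AB[of i k] that by (auto simp: s_def)
    show "\<not> s i j \<subseteq> A k" using uv[of i j] AB[of k j] that by (auto simp: s_def)
    show "\<not> s i j \<subseteq> B k" using uv[of i j] AB[of i k] that by (auto simp: s_def)
  qed
  have pos_region: "pos ` Y \<subseteq> ?R X" if "Y \<subseteq> X" for X Y using that by (auto simp: drawn_region_def)
  show False
  proof (rule no_planar_K33_of_connected_sets[of "\<lambda>i. ?R (A i)" "\<lambda>j. ?R (B j)" "\<lambda>i j. path_image (\<gamma> (s i j))"])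
    fix i j :: nat assume ij: "i < 3" "j < 3"
    show "path_connected (?R (A i))" using path_connected_drawn_region[OF G D A[OF ij(1)]] .
    show "compact (path_image (\<gamma> (s i j))) \<and> path_connected (path_image (\<gamma> (s i j)))"
      using drawing_edge(1)[OF D s(1)[OF ij ij(1)]]
      by (simp add: arc_imp_path compact_path_image path_connected_path_image)
    show "?R (A i) \<inter> ?R (B j) = {}"
      by (rule region_disj[OF AV(1)[OF ij(1)] AV(2)[OF ij(2)] AB[OF ij]])
    have "pos (u i j) \<in> ?R (A i)" using pos_region[of "{u i j}" "A i"] uv[OF ij] by simp
    then show "path_image (\<gamma> (s i j)) \<inter> ?R (A i) \<noteq> {}" using s(3)[OF ij ij(1)] by blast
    have "path_image (\<gamma> (s i j)) \<inter> ?R (B j) = {pos (v i j)}"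
    proof
      have "?R (B j) \<inter> path_image (\<gamma> (s i j)) \<subseteq> pos ` (B j \<inter> s i j)"
        by (rule region_edge[OF s(1,2)[OF ij ij(2)] AV(2)[OF ij(2)] s(6)[OF ij ij(2)]])
      moreover have "B j \<inter> s i j = {v i j}" using s(8)[OF ij ij(2)] by (simp add: Int_commute)
      ultimately show "path_image (\<gamma> (s i j)) \<inter> ?R (B j) \<subseteq> {pos (v i j)}" by auto
      show "{pos (v i j)} \<subseteq> path_image (\<gamma> (s i j)) \<inter> ?R (B j)"
        using pos_region[of "{v i j}" "B j"] uv[OF ij] s(4)[OF ij ij(1)] by simp
    qed
    then show "\<exists>x. path_image (\<gamma> (s i j)) \<inter> ?R (B j) = {x}" ..
  next
    fix j :: nat assume "j < 3"
    then show "path_connected (?R (B j))" using path_connected_drawn_region[OF G D B] by simp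
  next
    fix i k :: nat assume ik: "i < 3" "k < 3" "i \<noteq> k"
    show "?R (A i) \<inter> ?R (A k) = {}"
      by (rule region_disj[OF AV(1)[OF ik(1)] AV(1)[OF ik(2)] AA[OF ik]])
    show "?R (B i) \<inter> ?R (B k) = {}"
      by (rule region_disj[OF AV(2)[OF ik(1)] AV(2)[OF ik(2)] BB[OF ik]])
  next
    fix i j k :: nat assume ijk: "i < 3" "j < 3" "k < 3"
    have "?R (A k) \<inter> path_image (\<gamma> (s i j)) \<subseteq> pos ` (A k \<inter> s i j)"
      by (rule region_edge[OF s(1,2)[OF ijk] AV(1)[OF ijk(3)] s(5)[OF ijk]])
    moreover have "A k \<inter> s i j = {}" if "k \<noteq> i" using s(7)[OF ijk] that by (simp add: Int_commute)
    ultimately show "path_image (\<gamma> (s i j)) \<inter> ?R (A k) = {}" if "k \<noteq> i" using that by auto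
    have "?R (B k) \<inter> path_image (\<gamma> (s i j)) \<subseteq> pos ` (B k \<inter> s i j)"
      by (rule region_edge[OF s(1,2)[OF ijk] AV(2)[OF ijk(3)] s(6)[OF ijk]])
    moreover have "B k \<inter> s i j = {}" if "k \<noteq> j" using s(8)[OF ijk] that by (simp add: Int_commute)
    ultimately show "path_image (\<gamma> (s i j)) \<inter> ?R (B k) = {}" if "k \<noteq> j" using that by auto
  next
    fix i j k l :: nat
    assume ijkl: "i < 3" "j < 3" "k < 3" "l < 3" and ne: "(i, j) \<noteq> (k, l)"
    have common: "s i j \<inter> s k l \<subseteq> (if i = k then A i else if j = l then B j else {})"
      using uv[of i j] uv[of k l] AA[of i k] BB[of j l] AB[of i l] AB[of k j] ijkl ne
      by (auto simp: s_def)
    have "s i j \<noteq> s k l"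
    proof
      assume "s i j = s k l"
      then have "s i j \<subseteq> (if i = k then A i else if j = l then B j else {})" using common by auto
      then show False
        using s(5)[OF ijkl(1,2,1)] s(6)[OF ijkl(1,2,2)] by (auto simp: s_def split: if_splits)
    qed
    then have "path_image (\<gamma> (s i j)) \<inter> path_image (\<gamma> (s k l)) \<subseteq> pos ` (s i j \<inter> s k l)"
      by (rule nocross[OF s(1)[OF ijkl(1,2,1)] s(1)[OF ijkl(3,4,1)] _ s(2)[OF ijkl(1,2,1)]
            s(2)[OF ijkl(3,4,1)]])
    also have "\<dots> \<subseteq> (if i = k then ?R (A i) else if j = l then ?R (B j) else {})"
      using common pos_region by (auto split: if_splits)
    finally show "path_image (\<gamma> (s i j)) \<inter> path_image (\<gamma> (s k l)) \<subseteq>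
        (if i = k then ?R (A i) else if j = l then ?R (B j) else {})" .
  qed
qed

text \<open>Crossings chosen in different copies are different points: a crossing in one copy together with
  an edge of another copy would be a common point of three edges without common endpoint.\<close>

lemma num_crossings_ge_of_copies_K33_model:
  assumes G: "simple_graph G" and D: "is_drawing G pos \<gamma>"
    and M: "minor_model (copies_K33 n) G \<beta>"
  shows "enat n \<le> num_crossings G pos \<gamma>"
proof -
  define W where "W t = (\<Union>i<3. \<beta> (t, False, i) \<union> \<beta> (t, True, i))" for t
  have vertex: "(t, b, i) \<in> verts (copies_K33 n)" if "t < n" "i < 3" for t b i
    using that by (simp add: copies_K33_def)
  have model: "connected_in G (\<beta> (t, b, i))" if "t < n" "i < 3" for t b i
    using minor_modelD(1)[OF M vertex[OF that]] .
  have disj: "\<beta> (t, b, i) \<inter> \<beta> (t', b', i') = {}"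
    if "t < n" "i < 3" "t' < n" "i' < 3" "(t, b, i) \<noteq> (t', b', i')" for t b i t' b' i'
    using minor_modelD(2)[OF M vertex[OF that(1,2)] vertex[OF that(3,4)] that(5)] .
  have edge: "\<exists>u\<in>\<beta> (t, False, i). \<exists>v\<in>\<beta> (t, True, j). {u, v} \<in> edges G"
    if "t < n" "i < 3" "j < 3" for t i j
  proof -
    have "{(t, False, i), (t, True, j)} \<in> edges (copies_K33 n)"
      using that by (auto simp: copies_K33_def)
    then show ?thesis using minor_modelD(3)[OF M vertex vertex] that by simp
  qed
  have W_disj: "W t \<inter> W t' = {}" if tt: "t < n" "t' < n" "t \<noteq> t'" for t t'
  proof -
    have "\<beta> (t, b, i) \<inter> \<beta> (t', b', i') = {}" if "i < 3" "i' < 3" for b b' i i'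
      using disj[of t i t' i' b b'] tt that by simp
    then show ?thesis unfolding W_def by blast
  qed
  have "\<exists>p. \<exists>e\<in>edges G. \<exists>f\<in>edges G. e \<noteq> f \<and> e \<union> f \<subseteq> W t \<and>
          p \<in> path_image (\<gamma> e) \<inter> path_image (\<gamma> f) - pos ` (e \<inter> f)" if t: "t < n" for t
  proof -
    have "\<exists>e\<in>edges G. \<exists>f\<in>edges G. e \<noteq> f \<and> e \<union> f \<subseteq> (\<Union>i<3. \<beta> (t, False, i) \<union> \<beta> (t, True, i)) \<and>
           path_image (\<gamma> e) \<inter> path_image (\<gamma> f) - pos ` (e \<inter> f) \<noteq> {}"
      by (rule crossing_in_K33_model[OF G D]) (use model disj edge t in auto)
    then show ?thesis unfolding W_def by blast
  qed
  then obtain p where p: "\<And>t. t < n \<Longrightarrow> \<exists>e\<in>edges G. \<exists>f\<in>edges G. e \<noteq> f \<and> e \<union> f \<subseteq> W t \<and>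
          p t \<in> path_image (\<gamma> e) \<inter> path_image (\<gamma> f) - pos ` (e \<inter> f)" by metis
  have cross: "p ` {..<n} \<subseteq> crossings G pos \<gamma>"
    using p unfolding crossings_def by fastforce
  have "inj_on p {..<n}"
  proof (rule inj_onI, rule ccontr)
    fix t t' assume tt: "t \<in> {..<n}" "t' \<in> {..<n}" "p t = p t'" "t \<noteq> t'"
    obtain e f where ef: "e \<in> edges G" "f \<in> edges G" "e \<noteq> f" "e \<union> f \<subseteq> W t"
      "p t \<in> path_image (\<gamma> e) \<inter> path_image (\<gamma> f)" using p[of t] tt by auto
    obtain g where g: "g \<in> edges G" "g \<subseteq> W t'" "p t \<in> path_image (\<gamma> g)" using p[of t'] tt by auto
    have "W t \<inter> W t' = {}" using W_disj tt by simp
    then have "(e \<union> f) \<inter> g = {}" using ef(4) g(2) by blast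
    moreover have "g \<noteq> {}" using G g(1) by (auto simp: simple_graph_def)
    ultimately have "e \<noteq> g" "f \<noteq> g" "e \<inter> f \<inter> g = {}" by auto
    moreover have "path_image (\<gamma> e) \<inter> path_image (\<gamma> f) \<inter> path_image (\<gamma> g) \<subseteq> pos ` (e \<inter> f \<inter> g)"
      using D ef(1-3) g(1) \<open>e \<noteq> g\<close> \<open>f \<noteq> g\<close> by (simp add: is_drawing_def)
    ultimately show False using ef(5) g(3) by auto
  qed
  then have "card (p ` {..<n}) = n" by (simp add: card_image)
  then show ?thesis
    using card_mono[OF _ cross] by (auto simp: num_crossings_def)
qed

lemma crossing_number_ge_of_copies_K33_model:
  assumes "simple_graph G" "minor_model (copies_K33 n) G \<beta>"
  shows "enat n \<le> crossing_number G"
  unfolding crossing_number_def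
  by (rule Inf_greatest) (use num_crossings_ge_of_copies_K33_model assms in blast)

theorem mainTheorem4:
  fixes c :: nat
  shows "\<exists>\<C> :: ('a :: infinite) graph set.
           graph_class \<C> \<and> minor_closed \<C> \<and> proper_class \<C> \<and>
           (\<forall>G. simple_graph G \<and> crossing_number G \<le> enat c \<longrightarrow> G \<in> \<C>)"
proof (intro exI conjI allI impI)
  show "graph_class (minor_free (copies_K33 (Suc c)) :: 'a graph set)"
    by (rule graph_class_minor_free)
  show "minor_closed (minor_free (copies_K33 (Suc c)) :: 'a graph set)"
    by (rule minor_closed_minor_free)
  show "proper_class (minor_free (copies_K33 (Suc c)) :: 'a graph set)"
    by (rule proper_class_minor_free) (rule simple_graph_copies_K33)
next
  fix G :: "'a graph" assume G: "simple_graph G \<and> crossing_number G \<le> enat c"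
  have "\<not> enat (Suc c) \<le> crossing_number G"
    using G by (metis Suc_n_not_le_n enat_ord_simps(1) order_trans)
  then show "G \<in> minor_free (copies_K33 (Suc c))"
    using G crossing_number_ge_of_copies_K33_model[of G "Suc c"] unfolding minor_free_def by blast
qed

end
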